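(* Assume $\mathcal{D}\cap\mathcal{T}=\emptyset$, $\mathcal{D}\cap\mathcal{B}=\emptyset$ and $\mathcal{T}\cap\mathcal{C}=\emptyset$. The following two conditions are equivalent, and if either of them holds then the DDPOF is solvable for the system $\dot x=Ax+Bu+Dw$, $y=Cx$, $z=Tx$: (a) there exists an $(A,B)$-invariant and $(C,A)$-invariant set of nodes $\mathcal{W}$ such that $\mathcal{D}\subseteq\mathcal{W}\subseteq\mathcal{V}\setminus\mathcal{T}$; (b) letting $\mathcal{P}_1,\dots,\mathcal{P}_\ell$ be all possible $\mathcal{D}$-to-$\mathcal{T}$ paths, for every path $\mathcal{P}_j=\{v_1,\dots,v_{\kappa_j}\}$ (nodes relabeled along the path) of length $\kappa_j-1\geq1$, with $v_1\in\mathcal{D}$ and $v_{\kappa_j}\in\mathcal{T}$, there exists at least one sub-path of length 1 of the form $\{v_p,v_{p+1}\}$ with $v_p\in\mathcal{C}$ and $v_{p+1}\in\mathcal{B}$, $p\in\{1,\dots,\kappa_j-1\}$, $j\in\{1,\dots,\ell\}$.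
   Context: Let $(\mathcal{V},\mathcal{E},A)$ be a digraph with node set $\mathcal{V}=\{v_1,\dots,v_n\}$, edge set $\mathcal{E}$, where $(v_i,v_j)\in\mathcal{E}$ means $v_i\to v_j$, and weighted adjacency matrix $A\in\mathbb{R}^{n\times n}$ with $A_{ji}\neq0$ if and only if $(v_i,v_j)\in\mathcal{E}$. Let $\mathcal{B},\mathcal{C},\mathcal{D},\mathcal{T}\subseteq\mathcal{V}$ be the sets of input, output, disturbance and target nodes. The columns of $B$ (resp. $D$) are the canonical vectors $e_i$ with $v_i\in\mathcal{B}$ (resp. $v_i\in\mathcal{D}$); the rows of $C$ (resp. $T$) are the $e_i^\top$ with $v_i\in\mathcal{C}$ (resp. $v_i\in\mathcal{T}$). A node set $\mathcal{Z}$ is identified with the subspace $\mathrm{span}\{e_i:v_i\in\mathcal{Z}\}$ of $\mathbb{R}^n$, so sums of subspaces correspond to unions. A node set $\mathcal{W}$ is $(A,B)$-invariant if $A\mathcal{W}\subseteq\mathcal{W}+\mathcal{B}$, and $(C,A)$-invariant if $A(\mathcal{W}\setminus\mathcal{C})\subseteq\mathcal{W}$. The DDPOF (disturbance decoupling problem by output feedback, $u=-Gy$) is solvable if there exists $G\in\mathbb{R}^{|\mathcal{B}|\times|\mathcal{C}|}$ such that $T(sI-A+BGC)^{-1}D=0$ for all $s$ (as a rational matrix identity). A $\mathcal{D}$-to-$\mathcal{T}$ path is a sequence of distinct nodes, the first in $\mathcal{D}$ and the last in $\mathcal{T}$, in which each consecutive pair is an edge; its length is its number of edges. *)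

theory Defs
  imports
    "Jordan_Normal_Form.VS_Connect"
    "Graph_Theory.Graph_Theory"
    "HOL-Computational_Algebra.Polynomial_Factorial"
begin

text \<open>
  The nodes are \<open>0, \<dots>, n - 1\<close>, so node \<open>i\<close> corresponds to the unit vector \<open>unit_vec n i\<close>.
  Matrices and vectors have their dimensions in explicit carriers because the sizes of the
  input and output matrices are the cardinalities of node sets.
\<close>

locale weighted_digraph = pair_wf_digraph \<Gamma> for \<Gamma> :: "nat pair_pre_digraph" +
  fixes n :: nat and A :: "real mat"
  assumes verts_eq: "pverts \<Gamma> = {0..<n}"
    and A_carrier: "A \<in> carrier_mat n n"
    and A_nonzero_iff: "\<And>i j. i < n \<Longrightarrow> j < n \<Longrightarrow> A $$ (j, i) \<noteq> 0 \<longleftrightarrow> (i, j) \<in> parcs \<Gamma>"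

definition selection_cols :: "nat \<Rightarrow> nat set \<Rightarrow> real mat" where
  "selection_cols n Z = mat_of_cols n (map (unit_vec n) (sorted_list_of_set Z))"

definition selection_rows :: "nat \<Rightarrow> nat set \<Rightarrow> real mat" where
  "selection_rows n Z = mat_of_rows n (map (unit_vec n) (sorted_list_of_set Z))"

definition node_space :: "nat \<Rightarrow> nat set \<Rightarrow> real vec set" where
  "node_space n Z = LinearCombinations.module.span class_ring (module_vec TYPE(real) n) (unit_vec n ` Z)"

definition AB_invariant :: "nat \<Rightarrow> real mat \<Rightarrow> nat set \<Rightarrow> nat set \<Rightarrow> bool" where
  "AB_invariant n A \<B> \<W> \<longleftrightarrow>
     (\<lambda>v. A *\<^sub>v v) ` node_space n \<W>
       \<subseteq> {w + b | w b. w \<in> node_space n \<W> \<and> b \<in> node_space n \<B>}"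

definition CA_invariant :: "nat \<Rightarrow> real mat \<Rightarrow> nat set \<Rightarrow> nat set \<Rightarrow> bool" where
  "CA_invariant n A \<C> \<W> \<longleftrightarrow>
     (\<lambda>v. A *\<^sub>v v) ` node_space n (\<W> - \<C>) \<subseteq> node_space n \<W>"

text \<open>Rational functions in \<open>s\<close> are elements of \<open>real poly fract\<close>.\<close>

definition rat_s :: "real poly fract" where
  "rat_s = to_fract [:0, 1:]"

definition rat_mat :: "real mat \<Rightarrow> real poly fract mat" where
  "rat_mat = map_mat (\<lambda>c. to_fract [:c:])"

text \<open>
  The matrix \<open>R\<close> below is \<open>(s I - A + B G C)\<^sup>-\<^sup>1\<close>. It is unique, and it exists for every \<open>G\<close>
  because the determinant of \<open>s I - A + B G C\<close> is a monic polynomial in \<open>s\<close>.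
\<close>

definition DDPOF_solvable ::
    "nat \<Rightarrow> real mat \<Rightarrow> nat set \<Rightarrow> nat set \<Rightarrow> nat set \<Rightarrow> nat set \<Rightarrow> bool" where
  "DDPOF_solvable n A \<B> \<C> \<D> \<T> \<longleftrightarrow>
     (\<exists>G \<in> carrier_mat (card \<B>) (card \<C>). \<exists>R \<in> carrier_mat n n.
        let M = rat_s \<cdot>\<^sub>m 1\<^sub>m n - rat_mat A
                  + rat_mat (selection_cols n \<B> * G * selection_rows n \<C>)
        in inverts_mat M R \<and> inverts_mat R M \<and>
           rat_mat (selection_rows n \<T>) * R * rat_mat (selection_cols n \<D>)
             = 0\<^sub>m (card \<T>) (card \<D>))"

definition path_between ::
    "nat pair_pre_digraph \<Rightarrow> nat set \<Rightarrow> nat set \<Rightarrow> nat list \<Rightarrow> bool" where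
  "path_between \<Gamma> X Y p \<longleftrightarrow> vpath p (with_proj \<Gamma>) \<and> hd p \<in> X \<and> last p \<in> Y"

end

theory Submission
  imports Defs "Jordan_Normal_Form.Char_Poly"
begin

text \<open>
  A coordinate subspace consists of the vectors supported on its node set, so a matrix maps one
  coordinate subspace into another exactly when certain of its entries vanish. For a node set
  \<open>\<W>\<close>, being \<open>(A,B)\<close>-invariant then says that every arc leaving \<open>\<W>\<close> ends in \<open>\<B>\<close>, and being
  \<open>(C,A)\<close>-invariant that every arc leaving \<open>\<W>\<close> starts in \<open>\<C>\<close>
  (\<open>invariant_iff_leaving_entries\<close>). Call an arc from \<open>\<C>\<close> to \<open>\<B>\<close> cancellable. Condition (a)
  asks for a set that contains \<open>\<D>\<close>, avoids \<open>\<T>\<close>, and can only be left through cancellable arcs;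
  condition (b) asks that every path from \<open>\<D>\<close> to \<open>\<T>\<close> uses a cancellable arc. These are the two
  sides of a cut (\<open>every_path_uses_arc_iff_separating_set\<close>): a path has to leave the set somewhere,
  and conversely the nodes reachable from \<open>\<D>\<close> without cancellable arcs form such a set.

  Output feedback can change precisely the entries of \<open>A\<close> that belong to cancellable arcs, and it
  can change them independently, so a suitable gain \<open>G\<close> cancels all of them (\<open>block_feedback\<close>).
  No arc of the closed loop \<open>F = A - B G C\<close> leaves \<open>\<W>\<close> any more. Hence \<open>s I - F\<close> is block
  triangular with respect to \<open>\<W>\<close> and its complement, and its inverse has the same zero block
  (\<open>resolvent_zero_outside_invariant_set\<close>). The transfer matrix from \<open>\<D> \<subseteq> \<W>\<close> to
  \<open>\<T>\<close>, which lies outside \<open>\<W>\<close>, is a submatrix of that block.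
\<close>

section \<open>Matrices acting on coordinate subspaces\<close>

lemma index_mult_mat_sum:
  assumes "A \<in> carrier_mat m n" "B \<in> carrier_mat n q" "i < m" "j < q"
  shows "(A * B) $$ (i, j) = (\<Sum>k<n. A $$ (i, k) * B $$ (k, j))"
  using assms by (simp add: scalar_prod_def atLeast0LessThan)

lemma index_mult_mat_vec_sum:
  assumes "A \<in> carrier_mat m n" "v \<in> carrier_vec n" "i < m"
  shows "(A *\<^sub>v v) $ i = (\<Sum>k<n. A $$ (i, k) * v $ k)"
  using assms by (simp add: scalar_prod_def atLeast0LessThan)

lemma node_space_eq_support:
  assumes "Z \<subseteq> {0..<n}"
  shows "node_space n Z = {v \<in> carrier_vec n. \<forall>i<n. i \<notin> Z \<longrightarrow> v $ i = 0}"
proof -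
  interpret vec_space "TYPE(real)" n .
  let ?U = "unit_vec n ` Z :: real vec set"
  have fin: "finite ?U" using assms finite_subset by blast
  have carr: "?U \<subseteq> carrier_vec n" by auto
  have inj: "inj_on (unit_vec n :: nat \<Rightarrow> real vec) Z"
    using assms by (intro inj_onI) (metis atLeastLessThan_iff subsetD unit_vec_eq)
  have "finite Z" using assms finite_subset by blast
  have index: "lincomb a ?U $ i = (if i \<in> Z then a (unit_vec n i) else 0)" if "i < n" for a i
  proof -
    have "lincomb a ?U $ i = (\<Sum>z\<in>Z. a (unit_vec n z) * unit_vec n z $ i)"
      by (simp add: lincomb_index[OF that carr] sum.reindex[OF inj])
    also have "\<dots> = (\<Sum>z\<in>Z. if z = i then a (unit_vec n i) else 0)"
      using that assms by (intro sum.cong) (auto simp: index_unit_vec)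
    finally show ?thesis using \<open>finite Z\<close> by simp
  qed
  have span: "node_space n Z = {lincomb a ?U | a. True}"
    unfolding node_space_def using finite_span[OF fin] carr by auto
  show ?thesis
  proof (intro equalityI subsetI)
    fix v assume "v \<in> node_space n Z"
    then obtain a where "v = lincomb a ?U" using span by blast
    then show "v \<in> {v \<in> carrier_vec n. \<forall>i<n. i \<notin> Z \<longrightarrow> v $ i = 0}"
      using index lincomb_closed[OF carr] by auto
  next
    fix v :: "real vec"
    assume v: "v \<in> {v \<in> carrier_vec n. \<forall>i<n. i \<notin> Z \<longrightarrow> v $ i = 0}"
    \<comment> \<open>The unit vectors are orthonormal, so the coordinates of \<open>v\<close> are its scalar products with
      them; this gives coefficients as a function of the basis vector, not of its index.\<close>
    have "v = lincomb (\<lambda>u. v \<bullet> u) ?U"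
    proof (rule eq_vecI)
      show "dim_vec v = dim_vec (lincomb (\<lambda>u. v \<bullet> u) ?U)"
        using v carrier_vecD[OF lincomb_closed[OF carr, of "\<lambda>u. v \<bullet> u"]] by simp
    next
      fix i assume "i < dim_vec (lincomb (\<lambda>u. v \<bullet> u) ?U)"
      then have "i < n" using lincomb_closed[OF carr, of "\<lambda>u. v \<bullet> u"] by auto
      then show "v $ i = lincomb (\<lambda>u. v \<bullet> u) ?U $ i"
        using v by (auto simp: index scalar_prod_right_unit)
    qed
    then show "v \<in> node_space n Z" unfolding span by (intro CollectI exI conjI TrueI)
  qed
qed

lemma node_space_Un:
  assumes "X \<subseteq> {0..<n}" and "Y \<subseteq> {0..<n}"
  shows "{x + y | x y. x \<in> node_space n X \<and> y \<in> node_space n Y} = node_space n (X \<union> Y)"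
    (is "?L = _")
proof (intro equalityI subsetI)
  fix v assume "v \<in> ?L"
  then show "v \<in> node_space n (X \<union> Y)"
    using assms by (auto simp: node_space_eq_support)
next
  fix v assume v: "v \<in> node_space n (X \<union> Y)"
  let ?x = "vec n (\<lambda>i. if i \<in> X then v $ i else 0)"
  let ?y = "vec n (\<lambda>i. if i \<in> X then 0 else v $ i)"
  have "v = ?x + ?y" using v assms by (intro eq_vecI) (auto simp: node_space_eq_support)
  moreover have "?x \<in> node_space n X" "?y \<in> node_space n Y"
    using v assms by (auto simp: node_space_eq_support)
  ultimately show "v \<in> ?L" by blast
qed

text \<open>
  Column \<open>u\<close> of \<open>A\<close> is the image of the \<open>u\<close>-th unit vector, so the images of the spanning vectors
  lie in the target space exactly when those columns have no entries outside \<open>Y\<close>.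
\<close>

lemma mult_mat_vec_node_space_subset_iff:
  assumes A: "A \<in> carrier_mat n n" and X: "X \<subseteq> {0..<n}" and Y: "Y \<subseteq> {0..<n}"
  shows "(\<lambda>v. A *\<^sub>v v) ` node_space n X \<subseteq> node_space n Y \<longleftrightarrow>
    (\<forall>u\<in>X. \<forall>v<n. A $$ (v, u) \<noteq> 0 \<longrightarrow> v \<in> Y)" (is "?L \<longleftrightarrow> ?R")
proof
  assume L: ?L
  show ?R
  proof (intro ballI allI impI)
    fix u v assume u: "u \<in> X" and v: "v < n" and nz: "A $$ (v, u) \<noteq> 0"
    have "u < n" using u X by auto
    have "unit_vec n u \<in> node_space n X"
      using u X by (auto simp: node_space_eq_support index_unit_vec)
    then have "A *\<^sub>v unit_vec n u \<in> node_space n Y" using L by blast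
    moreover have "(A *\<^sub>v unit_vec n u) $ v = A $$ (v, u)"
      using A v \<open>u < n\<close> by (simp add: scalar_prod_right_unit)
    ultimately show "v \<in> Y" using v nz Y by (auto simp: node_space_eq_support)
  qed
next
  assume R: ?R
  have "(A *\<^sub>v x) $ v = 0" if x: "x \<in> node_space n X" and v: "v < n" "v \<notin> Y" for x v
  proof -
    have "A $$ (v, u) * x $ u = 0" if "u < n" for u
      using R x v that X by (cases "u \<in> X") (auto simp: node_space_eq_support)
    moreover have "x \<in> carrier_vec n" using x X by (simp add: node_space_eq_support)
    ultimately show ?thesis
      by (subst index_mult_mat_vec_sum[OF A _ v(1)]) (simp_all add: sum.neutral)
  qed
  then show ?L using A X Y by (auto simp: node_space_eq_support)
qed

text \<open>
  This turns the two subspace conditions into a single condition on the digraph: every arc from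
  \<open>\<W>\<close> to its complement goes from \<open>\<C>\<close> to \<open>\<B>\<close>. A node of \<open>\<W>\<close> outside \<open>\<C>\<close> may have no arc that
  leaves \<open>\<W>\<close>, and the sum of \<open>\<W>\<close> and \<open>\<B>\<close> adds only the nodes of \<open>\<B>\<close> as possible ends.
\<close>

lemma invariant_iff_leaving_entries:
  assumes A: "A \<in> carrier_mat n n" and W: "\<W> \<subseteq> {0..<n}" and B: "\<B> \<subseteq> {0..<n}"
  shows "AB_invariant n A \<B> \<W> \<and> CA_invariant n A \<C> \<W> \<longleftrightarrow>
    (\<forall>u\<in>\<W>. \<forall>v<n. v \<notin> \<W> \<and> A $$ (v, u) \<noteq> 0 \<longrightarrow> u \<in> \<C> \<and> v \<in> \<B>)"
proof -
  have "AB_invariant n A \<B> \<W> \<longleftrightarrow> (\<forall>u\<in>\<W>. \<forall>v<n. A $$ (v, u) \<noteq> 0 \<longrightarrow> v \<in> \<W> \<union> \<B>)"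
    using mult_mat_vec_node_space_subset_iff[OF A W, of "\<W> \<union> \<B>"] W B
    by (simp add: AB_invariant_def node_space_Un)
  moreover have
    "CA_invariant n A \<C> \<W> \<longleftrightarrow> (\<forall>u\<in>\<W> - \<C>. \<forall>v<n. A $$ (v, u) \<noteq> 0 \<longrightarrow> v \<in> \<W>)"
    using mult_mat_vec_node_space_subset_iff[OF A _ W, of "\<W> - \<C>"] W
    by (auto simp: CA_invariant_def)
  ultimately show ?thesis by blast
qed

section \<open>Paths and sets of nodes\<close>

lemma set_vwalk_arcs_conv_nth:
  "set (vwalk_arcs p) = {(p ! i, p ! Suc i) | i. Suc i < length p}"
proof -
  have "vwalk_arcs p = zip p (tl p)"
    by (induction p rule: vwalk_arcs.induct) auto
  then show ?thesis by (auto simp: set_zip nth_tl less_diff_conv)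
qed

lemma list_leaves_set:
  assumes "p \<noteq> []" and "hd p \<in> W" and "last p \<notin> W"
  shows "\<exists>i. Suc i < length p \<and> p ! i \<in> W \<and> p ! Suc i \<notin> W"
  using assms
proof (induction p rule: induct_list012)
  case (3 x y xs)
  show ?case
  proof (cases "y \<in> W")
    case True
    then obtain i where "Suc i < length (y # xs)" "(y # xs) ! i \<in> W" "(y # xs) ! Suc i \<notin> W"
      using 3 by auto
    then show ?thesis by (intro exI[of _ "Suc i"]) simp
  next
    case False
    then show ?thesis using 3 by (intro exI[of _ 0]) simp
  qed
qed auto

text \<open>
  The cut duality behind the equivalence, for an arbitrary set \<open>K\<close> of pairs. For the forward
  direction the separating set is what remains reachable from \<open>\<D>\<close> after the arcs in \<open>K\<close> are
  deleted: if it met \<open>\<T>\<close>, reachability would yield a path without repeated nodes that avoids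
  \<open>K\<close>. For the backward direction, a path from \<open>\<D>\<close> to \<open>\<T>\<close> starts inside the set and ends
  outside, so one of its arcs leaves the set.
\<close>

lemma every_path_uses_arc_iff_separating_set:
  fixes \<Gamma> :: "nat pair_pre_digraph"
  assumes "pair_wf_digraph \<Gamma>" and "\<D> \<subseteq> pverts \<Gamma>"
  shows "(\<forall>p. path_between \<Gamma> \<D> \<T> p \<longrightarrow> (\<exists>i. Suc i < length p \<and> (p ! i, p ! Suc i) \<in> K)) \<longleftrightarrow>
    (\<exists>W. \<D> \<subseteq> W \<and> W \<subseteq> pverts \<Gamma> - \<T> \<and> (\<forall>(u, v)\<in>parcs \<Gamma>. u \<in> W \<and> v \<notin> W \<longrightarrow> (u, v) \<in> K))"
    (is "?L \<longleftrightarrow> ?R")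
proof
  assume L: ?L
  interpret pair_wf_digraph \<Gamma> by fact
  define \<Delta> where "\<Delta> = \<lparr>pverts = pverts \<Gamma>, parcs = parcs \<Gamma> - K\<rparr>"
  interpret \<Delta>: pair_wf_digraph \<Delta>
    by unfold_locales (auto simp: \<Delta>_def dest: in_arcsD1 in_arcsD2)
  define W where "W = {v. \<exists>d\<in>\<D>. d \<rightarrow>\<^sup>*\<^bsub>with_proj \<Delta>\<^esub> v}"
  have "\<D> \<subseteq> W"
  proof
    fix d assume "d \<in> \<D>"
    moreover from this have "d \<rightarrow>\<^sup>*\<^bsub>with_proj \<Delta>\<^esub> d"
      using assms(2) by (intro \<Delta>.reachable_refl) (auto simp: \<Delta>_def)
    ultimately show "d \<in> W" unfolding W_def by blast
  qed
  moreover have "W \<subseteq> pverts \<Gamma>"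
  proof
    fix v assume "v \<in> W"
    then obtain d where "d \<rightarrow>\<^sup>*\<^bsub>with_proj \<Delta>\<^esub> v" unfolding W_def by blast
    from \<Delta>.reachable_in_verts(2)[OF this] show "v \<in> pverts \<Gamma>" by (simp add: \<Delta>_def)
  qed
  moreover have "t \<notin> \<T>" if "t \<in> W" for t
  proof
    assume "t \<in> \<T>"
    from that obtain p where p: "vpath p (with_proj \<Delta>)" "hd p \<in> \<D>" "last p = t"
      unfolding W_def using \<Delta>.reachable_vpath_conv by auto
    then have arcs: "set (vwalk_arcs p) \<subseteq> parcs \<Gamma> - K" and "vpath p (with_proj \<Gamma>)"
      by (auto simp: vpath_def vwalk_def \<Delta>_def)
    with L p \<open>t \<in> \<T>\<close> obtain i where "Suc i < length p" "(p ! i, p ! Suc i) \<in> K"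
      by (auto simp: path_between_def)
    with arcs show False by (auto simp: set_vwalk_arcs_conv_nth)
  qed
  moreover have "(u, v) \<in> K" if "(u, v) \<in> parcs \<Gamma>" "u \<in> W" "v \<notin> W" for u v
  proof (rule ccontr)
    assume "(u, v) \<notin> K"
    then have "u \<rightarrow>\<^bsub>with_proj \<Delta>\<^esub> v" using that by (simp add: \<Delta>_def)
    then show False using that \<Delta>.reachable_adj_trans by (auto simp: W_def)
  qed
  ultimately show ?R by (intro exI[of _ W]) auto
next
  assume ?R
  then obtain W where W: "\<D> \<subseteq> W" "W \<subseteq> pverts \<Gamma> - \<T>"
    and leave: "\<forall>(u, v)\<in>parcs \<Gamma>. u \<in> W \<and> v \<notin> W \<longrightarrow> (u, v) \<in> K"
    by (elim exE conjE)
  show ?L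
  proof (intro allI impI)
    fix p assume p: "path_between \<Gamma> \<D> \<T> p"
    then have "p \<noteq> []" and arcs: "set (vwalk_arcs p) \<subseteq> parcs \<Gamma>"
      by (auto simp: path_between_def vpath_def vwalk_def)
    moreover have "hd p \<in> W" "last p \<notin> W" using p W by (auto simp: path_between_def)
    ultimately obtain i where i: "Suc i < length p" "p ! i \<in> W" "p ! Suc i \<notin> W"
      using list_leaves_set by blast
    then have "(p ! i, p ! Suc i) \<in> parcs \<Gamma>" using arcs by (auto simp: set_vwalk_arcs_conv_nth)
    with i leave have "(p ! i, p ! Suc i) \<in> K" by auto
    with i(1) show "\<exists>i. Suc i < length p \<and> (p ! i, p ! Suc i) \<in> K" by blast
  qed
qed

section \<open>Resolvents over the rational functions\<close>

text \<open>
  Over the rational functions this determinant is the image of the characteristic polynomial of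
  \<open>A\<close>, which is monic.
\<close>

lemma det_resolvent_nonzero:
  assumes A: "A \<in> carrier_mat n n"
  shows "det (rat_s \<cdot>\<^sub>m 1\<^sub>m n - rat_mat A) \<noteq> 0"
proof -
  interpret inj_comm_ring_hom "to_fract :: real poly \<Rightarrow> real poly fract"
    by unfold_locales auto
  have "rat_s \<cdot>\<^sub>m 1\<^sub>m n - rat_mat A = map_mat to_fract (char_poly_matrix A)"
    using A by (intro eq_matI) (auto simp: rat_s_def rat_mat_def char_poly_matrix_def
        simp flip: to_fract_diff to_fract_uminus)
  then have "det (rat_s \<cdot>\<^sub>m 1\<^sub>m n - rat_mat A) = to_fract (char_poly A)"
    by (simp add: char_poly_def)
  moreover have "char_poly A \<noteq> 0"
    using degree_monic_char_poly[OF A] by auto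
  ultimately show ?thesis by simp
qed

lemma resolvent_exists:
  assumes A: "A \<in> carrier_mat n n"
  defines "M \<equiv> rat_s \<cdot>\<^sub>m 1\<^sub>m n - rat_mat A"
  obtains R where "R \<in> carrier_mat n n" "M * R = 1\<^sub>m n" "R * M = 1\<^sub>m n"
proof -
  have "M \<in> carrier_mat n n" using A by (auto simp: M_def rat_mat_def)
  from det_non_zero_imp_unit[OF this, of "()"] show ?thesis
    using that det_resolvent_nonzero[OF A] by (auto simp: M_def Units_def ring_mat_simps)
qed

text \<open>
  Let \<open>y\<close> be column \<open>j\<close> of \<open>R\<close> with the entries in \<open>W\<close> replaced by zero. Invariance of \<open>W\<close> means
  that the rows outside \<open>W\<close> of the equation for this column involve only \<open>y\<close>, and the right-hand
  side, a unit vector in \<open>W\<close>, vanishes there. So \<open>y\<close> solves a homogeneous system whose matrix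
  is again of the form \<open>s I - N\<close> and hence nonsingular.
\<close>

lemma resolvent_zero_outside_invariant_set:
  assumes A: "A \<in> carrier_mat n n" and R: "R \<in> carrier_mat n n"
    and MR: "(rat_s \<cdot>\<^sub>m 1\<^sub>m n - rat_mat A) * R = 1\<^sub>m n"
    and inv: "\<And>i j. i < n \<Longrightarrow> j \<in> W \<Longrightarrow> i \<notin> W \<Longrightarrow> A $$ (i, j) = 0"
    and ij: "i < n" "i \<notin> W" "j < n" "j \<in> W"
  shows "R $$ (i, j) = 0"
proof -
  \<comment> \<open>The diagonal block of \<open>A\<close> on the complement of \<open>W\<close>, padded with zeros to size \<open>n\<close> so that
    \<open>s I - N\<close> is still a nonsingular square matrix of the same size.\<close>
  define N where "N = mat n n (\<lambda>(i, k). if i \<in> W \<or> k \<in> W then 0 else A $$ (i, k))"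
  define y where "y = vec n (\<lambda>k. if k \<in> W then 0 else R $$ (k, j))"
  let ?M = "rat_s \<cdot>\<^sub>m 1\<^sub>m n - rat_mat A" and ?N = "rat_s \<cdot>\<^sub>m 1\<^sub>m n - rat_mat N"
  have N: "N \<in> carrier_mat n n" by (simp add: N_def)
  have Mcarr: "?M \<in> carrier_mat n n" using A by (auto simp: rat_mat_def)
  have Ncarr: "?N \<in> carrier_mat n n" using N by (auto simp: rat_mat_def)
  have y: "y \<in> carrier_vec n" by (simp add: y_def)
  have "(?N *\<^sub>v y) $ l = 0" if l: "l < n" for l
  proof (cases "l \<in> W")
    case True
    have "(?N *\<^sub>v y) $ l = (\<Sum>k<n. ?N $$ (l, k) * y $ k)"
      by (rule index_mult_mat_vec_sum[OF Ncarr y l])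
    also have "\<dots> = 0"
      using True l by (intro sum.neutral) (auto simp: N_def y_def rat_mat_def)
    finally show ?thesis .
  next
    case False
    have "(?N *\<^sub>v y) $ l = (\<Sum>k<n. ?N $$ (l, k) * y $ k)"
      by (rule index_mult_mat_vec_sum[OF Ncarr y l])
    also have "\<dots> = (\<Sum>k<n. ?M $$ (l, k) * R $$ (k, j))"
      using False l A inv[of l] by (intro sum.cong) (auto simp: N_def y_def rat_mat_def)
    also have "\<dots> = (?M * R) $$ (l, j)"
      by (rule index_mult_mat_sum[OF Mcarr R l ij(3), symmetric])
    also have "\<dots> = 0" using MR l ij False by auto
    finally show ?thesis .
  qed
  then have "?N *\<^sub>v y = 0\<^sub>v n" using Ncarr by (intro eq_vecI) auto
  with y have "y = 0\<^sub>v n"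
    using det_0_iff_vec_prod_zero_field[OF Ncarr] det_resolvent_nonzero[OF N] by blast
  then have "y $ i = 0" using ij by simp
  then show ?thesis using ij by (simp add: y_def)
qed

section \<open>Feedback that deletes arcs\<close>

lemma index_selection_rows:
  assumes "finite Z" "k < card Z" "j < n"
  shows "selection_rows n Z $$ (k, j) = (if j = sorted_list_of_set Z ! k then 1 else 0)"
  using assms by (simp add: selection_rows_def mat_of_rows_index unit_vec_def)

lemma index_selection_cols:
  assumes "finite Z" "k < card Z" "i < n"
  shows "selection_cols n Z $$ (i, k) = (if i = sorted_list_of_set Z ! k then 1 else 0)"
  using assms by (simp add: selection_cols_def mat_of_cols_index unit_vec_def)

lemma selection_rows_carrier:
  "selection_rows n Z \<in> carrier_mat (card Z) n"
  using mat_of_rows_carrier(1)[of n "map (unit_vec n) (sorted_list_of_set Z)"]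
  by (simp add: selection_rows_def)

lemma selection_cols_carrier:
  "selection_cols n Z \<in> carrier_mat n (card Z)"
  using mat_of_cols_carrier(1)[of n "map (unit_vec n) (sorted_list_of_set Z)"]
  by (simp add: selection_cols_def)

lemma sum_sorted_list_of_set:
  assumes "finite Z"
  shows "(\<Sum>k<card Z. h (sorted_list_of_set Z ! k)) = (\<Sum>z\<in>Z. h z)"
proof -
  have "bij_betw (\<lambda>k. sorted_list_of_set Z ! k) {..<card Z} Z"
    using assms by (intro bij_betw_nth) auto
  then show ?thesis by (rule sum.reindex_bij_betw)
qed

text \<open>
  The matrices \<open>B\<close> and \<open>C\<close> only place the entries of \<open>G\<close> at the positions \<open>\<B> \<times> \<C>\<close>, so every
  matrix supported there is of the form \<open>B G C\<close>. This instance reproduces the entries of \<open>A\<close>, so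
  that subtracting it removes all arcs from \<open>\<C>\<close> to \<open>\<B>\<close>.
\<close>

lemma block_feedback:
  assumes A: "A \<in> carrier_mat n n" and B: "\<B> \<subseteq> {0..<n}" and C: "\<C> \<subseteq> {0..<n}"
  obtains G where "G \<in> carrier_mat (card \<B>) (card \<C>)"
    and "selection_cols n \<B> * G * selection_rows n \<C> =
      mat n n (\<lambda>(i, j). if i \<in> \<B> \<and> j \<in> \<C> then A $$ (i, j) else 0)"
proof
  let ?b = "\<lambda>k. sorted_list_of_set \<B> ! k" and ?c = "\<lambda>l. sorted_list_of_set \<C> ! l"
  define G where "G = mat (card \<B>) (card \<C>) (\<lambda>(k, l). A $$ (?b k, ?c l))"
  show "G \<in> carrier_mat (card \<B>) (card \<C>)" by (simp add: G_def)
  have fin: "finite \<B>" "finite \<C>" using B C finite_subset by blast+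
  note carr = selection_cols_carrier[of n \<B>] selection_rows_carrier[of n \<C>]
  have BG: "(selection_cols n \<B> * G) $$ (i, l) = (if i \<in> \<B> then A $$ (i, ?c l) else 0)"
    if "i < n" "l < card \<C>" for i l
  proof -
    have "(selection_cols n \<B> * G) $$ (i, l)
        = (\<Sum>k<card \<B>. if i = ?b k then A $$ (?b k, ?c l) else 0)"
      using that carr fin
      by (simp add: scalar_prod_def G_def index_selection_cols atLeast0LessThan
          if_distrib if_distribR cong: if_cong)
    also have "\<dots> = (\<Sum>b\<in>\<B>. if i = b then A $$ (b, ?c l) else 0)"
      by (rule sum_sorted_list_of_set[OF fin(1)])
    finally show ?thesis using fin by simp
  qed
  show "selection_cols n \<B> * G * selection_rows n \<C> =
      mat n n (\<lambda>(i, j). if i \<in> \<B> \<and> j \<in> \<C> then A $$ (i, j) else 0)" (is "?L = ?R")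
  proof (rule eq_matI)
    fix i j assume "i < dim_row ?R" "j < dim_col ?R"
    then have ij: "i < n" "j < n" by auto
    have "?L $$ (i, j) = (\<Sum>l<card \<C>. (selection_cols n \<B> * G) $$ (i, l) * selection_rows n \<C> $$ (l, j))"
      using ij carr by (intro index_mult_mat_sum) (auto simp: G_def)
    also have "\<dots> = (\<Sum>l<card \<C>. if j = ?c l then (if i \<in> \<B> then A $$ (i, ?c l) else 0) else 0)"
      using ij fin by (intro sum.cong) (auto simp: BG index_selection_rows simp del: index_mult_mat)
    also have "\<dots> = (\<Sum>c\<in>\<C>. if j = c then (if i \<in> \<B> then A $$ (i, c) else 0) else 0)"
      by (rule sum_sorted_list_of_set[OF fin(2)])
    also have "\<dots> = ?R $$ (i, j)" using fin ij by simp
    finally show "?L $$ (i, j) = ?R $$ (i, j)" .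
  qed (use carr in auto)
qed

lemma selected_block_eq_zero:
  assumes R: "R \<in> carrier_mat n n" and T: "\<T> \<subseteq> {0..<n}" and D: "\<D> \<subseteq> {0..<n}"
    and zero: "\<And>t d. t \<in> \<T> \<Longrightarrow> d \<in> \<D> \<Longrightarrow> R $$ (t, d) = 0"
  shows "rat_mat (selection_rows n \<T>) * R * rat_mat (selection_cols n \<D>) = 0\<^sub>m (card \<T>) (card \<D>)"
    (is "?T * R * ?D = _")
proof (rule eq_matI)
  have fin: "finite \<T>" "finite \<D>" using T D finite_subset by blast+
  have carr: "?T \<in> carrier_mat (card \<T>) n" "?D \<in> carrier_mat n (card \<D>)"
    using selection_rows_carrier[of n \<T>] selection_cols_carrier[of n \<D>]
    by (simp_all add: rat_mat_def)
  show "dim_row (?T * R * ?D) = dim_row (0\<^sub>m (card \<T>) (card \<D>))"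
    "dim_col (?T * R * ?D) = dim_col (0\<^sub>m (card \<T>) (card \<D>))" using carr by auto
  fix k l
  assume "k < dim_row (0\<^sub>m (card \<T>) (card \<D>))" "l < dim_col (0\<^sub>m (card \<T>) (card \<D>))"
  then have kl: "k < card \<T>" "l < card \<D>" by auto
  let ?t = "sorted_list_of_set \<T> ! k" and ?d = "sorted_list_of_set \<D> ! l"
  have td: "?t \<in> \<T>" "?d \<in> \<D>"
    using kl fin by (metis length_sorted_list_of_set nth_mem set_sorted_list_of_set)+
  have T': "?T $$ (k, j) = (if j = ?t then 1 else 0)" if "j < n" for j
    using that kl fin carr selection_rows_carrier[of n \<T>]
    by (simp add: rat_mat_def index_selection_rows flip: one_pCons)
  have D': "?D $$ (j, l) = (if j = ?d then 1 else 0)" if "j < n" for j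
    using that kl fin carr selection_cols_carrier[of n \<D>]
    by (simp add: rat_mat_def index_selection_cols flip: one_pCons)
  have TR: "(?T * R) $$ (k, j) = R $$ (?t, j)" if "j < n" for j
  proof -
    have "(?T * R) $$ (k, j) = (\<Sum>m<n. ?T $$ (k, m) * R $$ (m, j))"
      using that carr R kl by (intro index_mult_mat_sum) auto
    also have "\<dots> = (\<Sum>m<n. if m = ?t then R $$ (m, j) else 0)"
      by (intro sum.cong) (auto simp: T')
    finally show ?thesis using td T by auto
  qed
  have "(?T * R * ?D) $$ (k, l) = (\<Sum>j<n. (?T * R) $$ (k, j) * ?D $$ (j, l))"
    using carr R kl by (intro index_mult_mat_sum) auto
  also have "\<dots> = (\<Sum>j<n. if j = ?d then R $$ (?t, j) else 0)"
    by (intro sum.cong) (auto simp: TR D' simp del: index_mult_mat)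
  also have "\<dots> = 0" using td zero by simp
  finally show "(?T * R * ?D) $$ (k, l) = 0\<^sub>m (card \<T>) (card \<D>) $$ (k, l)" using kl by simp
qed

text \<open>
  All arcs that leave \<open>W\<close> are among those the feedback can cancel, so \<open>W\<close> becomes invariant under
  the closed loop and shields \<open>\<T>\<close> from \<open>\<D>\<close>.
\<close>

lemma DDPOF_solvable_if_leaving_entries:
  assumes A: "A \<in> carrier_mat n n" and B: "\<B> \<subseteq> {0..<n}" and C: "\<C> \<subseteq> {0..<n}"
    and D: "\<D> \<subseteq> W" and W: "W \<subseteq> {0..<n} - \<T>" and T: "\<T> \<subseteq> {0..<n}"
    and leave: "\<forall>u\<in>W. \<forall>v<n. v \<notin> W \<and> A $$ (v, u) \<noteq> 0 \<longrightarrow> u \<in> \<C> \<and> v \<in> \<B>"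
  shows "DDPOF_solvable n A \<B> \<C> \<D> \<T>"
proof -
  obtain G where G: "G \<in> carrier_mat (card \<B>) (card \<C>)"
    and BGC: "selection_cols n \<B> * G * selection_rows n \<C> =
      mat n n (\<lambda>(i, j). if i \<in> \<B> \<and> j \<in> \<C> then A $$ (i, j) else 0)" (is "_ = ?K")
    using block_feedback[OF A B C] .
  define F where "F = A - ?K"
  have F: "F \<in> carrier_mat n n" using A by (auto simp: F_def)
  obtain R where R: "R \<in> carrier_mat n n"
    and inv: "(rat_s \<cdot>\<^sub>m 1\<^sub>m n - rat_mat F) * R = 1\<^sub>m n" "R * (rat_s \<cdot>\<^sub>m 1\<^sub>m n - rat_mat F) = 1\<^sub>m n"
    using resolvent_exists[OF F] .
  have M: "rat_s \<cdot>\<^sub>m 1\<^sub>m n - rat_mat A + rat_mat ?K = rat_s \<cdot>\<^sub>m 1\<^sub>m n - rat_mat F"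
    using A by (intro eq_matI)
      (auto simp: F_def rat_mat_def simp flip: to_fract_add to_fract_diff to_fract_uminus)
  have "F $$ (i, j) = 0" if "i < n" "j \<in> W" "i \<notin> W" for i j
  proof -
    have "j < n" using that W by auto
    moreover have "A $$ (i, j) = 0 \<or> i \<in> \<B> \<and> j \<in> \<C>" using that leave by blast
    ultimately show ?thesis using that A by (auto simp: F_def)
  qed
  then have "R $$ (t, d) = 0" if "t \<in> \<T>" "d \<in> \<D>" for t d
    using that D W T by (intro resolvent_zero_outside_invariant_set[OF F R inv(1), of W]) auto
  then have "rat_mat (selection_rows n \<T>) * R * rat_mat (selection_cols n \<D>) = 0\<^sub>m (card \<T>) (card \<D>)"
    using D W by (intro selected_block_eq_zero[OF R T]) auto
  moreover have "dim_row (rat_s \<cdot>\<^sub>m 1\<^sub>m n - rat_mat F) = n" using F by (simp add: rat_mat_def)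
  ultimately show ?thesis
    unfolding DDPOF_solvable_def Let_def using R inv
    by (intro bexI[OF _ G] bexI[OF _ R], unfold BGC M inverts_mat_def) auto
qed

section \<open>The equivalence\<close>

theorem theorem3:
  fixes \<Gamma> :: "nat pair_pre_digraph"
    and n :: nat
    and A :: "real mat"
    and \<B> \<C> \<D> \<T> :: "nat set"
  assumes "weighted_digraph \<Gamma> n A"
    and "\<B> \<subseteq> pverts \<Gamma>" and "\<C> \<subseteq> pverts \<Gamma>" and "\<D> \<subseteq> pverts \<Gamma>" and "\<T> \<subseteq> pverts \<Gamma>"
    and "\<D> \<inter> \<T> = {}" and "\<D> \<inter> \<B> = {}" and "\<T> \<inter> \<C> = {}"
  shows "let cond_a = (\<exists>\<W>. AB_invariant n A \<B> \<W> \<and> CA_invariant n A \<C> \<W> \<and>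
                            \<D> \<subseteq> \<W> \<and> \<W> \<subseteq> pverts \<Gamma> - \<T>);
             cond_b = (\<forall>p. path_between \<Gamma> \<D> \<T> p \<and> 1 \<le> vwalk_length p \<longrightarrow>
                            (\<exists>i. Suc i < length p \<and> p ! i \<in> \<C> \<and> p ! Suc i \<in> \<B>))
         in (cond_a \<longleftrightarrow> cond_b) \<and> (cond_a \<or> cond_b \<longrightarrow> DDPOF_solvable n A \<B> \<C> \<D> \<T>)"
proof -
  interpret weighted_digraph \<Gamma> n A by fact
  let ?leave = "\<lambda>W. \<forall>u\<in>W. \<forall>v<n. v \<notin> W \<and> A $$ (v, u) \<noteq> 0 \<longrightarrow> u \<in> \<C> \<and> v \<in> \<B>"
  let ?a = "\<exists>\<W>. AB_invariant n A \<B> \<W> \<and> CA_invariant n A \<C> \<W> \<and> \<D> \<subseteq> \<W> \<and> \<W> \<subseteq> pverts \<Gamma> - \<T>"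
  let ?b = "\<forall>p. path_between \<Gamma> \<D> \<T> p \<and> 1 \<le> vwalk_length p \<longrightarrow>
      (\<exists>i. Suc i < length p \<and> p ! i \<in> \<C> \<and> p ! Suc i \<in> \<B>)"
  have inv: "AB_invariant n A \<B> W \<and> CA_invariant n A \<C> W \<longleftrightarrow> ?leave W"
    if "W \<subseteq> pverts \<Gamma> - \<T>" for W
    using that assms(2) A_carrier verts_eq by (intro invariant_iff_leaving_entries) auto
  have arcs: "?leave W \<longleftrightarrow> (\<forall>(u, v)\<in>parcs \<Gamma>. u \<in> W \<and> v \<notin> W \<longrightarrow> (u, v) \<in> \<C> \<times> \<B>)"
    if W: "W \<subseteq> pverts \<Gamma> - \<T>" for W
  proof -
    have "u < n \<and> v < n" if "(u, v) \<in> parcs \<Gamma>" for u v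
      using in_arcsD1[OF that] in_arcsD2[OF that] verts_eq by auto
    moreover have "u < n" if "u \<in> W" for u using that W verts_eq by auto
    ultimately have "(u \<in> W \<and> v < n \<and> A $$ (v, u) \<noteq> 0) \<longleftrightarrow> (u \<in> W \<and> (u, v) \<in> parcs \<Gamma>)" for u v
      using A_nonzero_iff[of u v] by blast
    then show ?thesis by blast
  qed
  \<comment> \<open>A path of length zero would be a single node in both \<open>\<D>\<close> and \<open>\<T>\<close>.\<close>
  have len: "1 \<le> vwalk_length p" if path: "path_between \<Gamma> \<D> \<T> p" for p
  proof (rule ccontr)
    assume "\<not> 1 \<le> vwalk_length p"
    then obtain x where "p = [x]"
      using path by (cases p) (auto simp: path_between_def vpath_def vwalk_def Suc_le_eq)
    then show False using path assms(6) by (auto simp: path_between_def)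
  qed
  have "?a \<longleftrightarrow> (\<exists>W. \<D> \<subseteq> W \<and> W \<subseteq> pverts \<Gamma> - \<T> \<and>
      (\<forall>(u, v)\<in>parcs \<Gamma>. u \<in> W \<and> v \<notin> W \<longrightarrow> (u, v) \<in> \<C> \<times> \<B>))"
  proof (rule ex_cong1)
    fix W
    show "(AB_invariant n A \<B> W \<and> CA_invariant n A \<C> W \<and> \<D> \<subseteq> W \<and> W \<subseteq> pverts \<Gamma> - \<T>) \<longleftrightarrow>
      (\<D> \<subseteq> W \<and> W \<subseteq> pverts \<Gamma> - \<T> \<and>
        (\<forall>(u, v)\<in>parcs \<Gamma>. u \<in> W \<and> v \<notin> W \<longrightarrow> (u, v) \<in> \<C> \<times> \<B>))"
    proof (cases "W \<subseteq> pverts \<Gamma> - \<T>")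
      case True
      show ?thesis using inv[OF True] unfolding arcs[OF True, symmetric] by blast
    qed blast
  qed
  also have "\<dots> \<longleftrightarrow> ?b"
    using every_path_uses_arc_iff_separating_set[OF pair_wf_digraph_axioms assms(4), of \<T> "\<C> \<times> \<B>"] len
    by auto
  finally have ab: "?a \<longleftrightarrow> ?b" .
  have "DDPOF_solvable n A \<B> \<C> \<D> \<T>" if ?a
  proof -
    from that obtain W where W: "\<D> \<subseteq> W" "W \<subseteq> pverts \<Gamma> - \<T>" "?leave W" using inv by blast
    then show ?thesis
      using assms(2,3,5) A_carrier verts_eq
      by (intro DDPOF_solvable_if_leaving_entries[of A n \<B> \<C> \<D> W \<T>]) auto
  qed
  with ab show ?thesis unfolding Let_def by blast
qed

end
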